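(* Let $w = 1\square 0\square 0$, a partial word over $\{0,1\}$ (with $\square$ denoting a missing coordinate). Then the subshift $X_w \subset \{0,1\}^{\mathbb{Z}}$ has subquadratic growth.
   Context: The shift map on $S^{\mathbb{Z}}$ is $\sigma(x)_i = x_{i+1}$, where $S$ is a finite alphabet and $S^{\mathbb{Z}}$ has the product topology. A word $u$ of length $n$ appears in a point $x$ if $u = x_i x_{i+1} \cdots x_{i+n-1}$ for some $i \in \mathbb{Z}$. A subshift $X$ has subquadratic growth if the number of words of length $n$ that appear in the points of $X$ grows slower than quadratically in $n$, that is, it is $o(n^2)$. Let $\square \notin S$. For a word $u$, $|u|$ is its length, words are $0$-indexed, $|u|_{\square}$ is the number of occurrences of $\square$ in $u$, and $u^{\mathbb{Z}}$ is the point with $(u^{\mathbb{Z}})_i = u_{i \bmod |u|}$. For a point $y$, $y_{[a,b]}$ denotes the word $y_a y_{a+1} \cdots y_b$. For $y, z \in (S \cup \{\square\})^{\mathbb{Z}}$, where $\square$ occurs infinitely often in both tails of $y$, let $\phi(y,z)$ be the point obtained by writing $z$ in order into the $\square$-coordinates of $y$: if $\ell \geq 0$ is the least nonnegative coordinate with $y_\ell = \square$, then $\phi(y,z)_j = y_j$ if $y_j \neq \square$; $\phi(y,z)_\ell = z_0$; $\phi(y,z)_j = z_k$ with $k = |y_{[\ell,j-1]}|_{\square}$ if $y_j = \square$ and $j > \ell$; $\phi(y,z)_j = z_{-k}$ with $k = |y_{[j+1,\ell]}|_{\square}$ if $y_j = \square$ and $j < \ell$. For a word $w$ over $S \cup \{\square\}$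 with at least one $\square$ and with first and last symbols in $S$, let $x^0(w) = \square^{\mathbb{Z}}$, $x^{i+1}(w) = \phi(x^i(w), w^{\mathbb{Z}})$, and $x(w) = \lim_i x^i(w) \in S^{\mathbb{Z}}$ (the limit exists and contains no $\square$). Then $X_w = \overline{\{\sigma^i(x(w)) \mid i \in \mathbb{Z}\}}$. *)

theory Defs
  imports "HOL-Analysis.Analysis" "HOL-Library.Landau_Symbols"
begin

text \<open>
  Bi-infinite points over an alphabet of symbols of type \<open>'a\<close> are functions \<open>int \<Rightarrow> 'a\<close>, words are
  lists. The missing-coordinate symbol (the square) is \<open>None\<close>, so points and words over the
  alphabet extended by the square are over \<open>'a option\<close>.
\<close>

definition full_shift_topology :: "'a set \<Rightarrow> (int \<Rightarrow> 'a) topology" where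
  "full_shift_topology S = product_topology (\<lambda>_. discrete_topology S) UNIV"

definition shift :: "(int \<Rightarrow> 'a) \<Rightarrow> int \<Rightarrow> 'a" where
  "shift x = (\<lambda>i. x (i + 1))"

definition shift_pow :: "int \<Rightarrow> (int \<Rightarrow> 'a) \<Rightarrow> int \<Rightarrow> 'a" where
  "shift_pow k x = (\<lambda>i. x (i + k))"

text \<open>The next two lemmas characterise \<open>shift_pow k\<close>, for \<open>k\<close> of either sign, as the \<open>k\<close>-th
  power of the bijection \<open>shift\<close>.\<close>

lemma shift_pow_0: "shift_pow 0 x = x"
  by (simp add: shift_pow_def)

lemma shift_pow_Suc: "shift_pow (k + 1) x = shift (shift_pow k x)"
  by (simp add: shift_pow_def shift_def algebra_simps)

definition subword :: "(int \<Rightarrow> 'a) \<Rightarrow> int \<Rightarrow> int \<Rightarrow> 'a list" where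
  "subword x a b = map x [a..b]"

definition appears_in :: "'a list \<Rightarrow> (int \<Rightarrow> 'a) \<Rightarrow> bool" where
  "appears_in u x \<longleftrightarrow> (\<exists>i. u = subword x i (i + int (length u) - 1))"

definition words_of_length :: "(int \<Rightarrow> 'a) set \<Rightarrow> nat \<Rightarrow> 'a list set" where
  "words_of_length X n = {u. length u = n \<and> (\<exists>x\<in>X. appears_in u x)}"

definition subquadratic_growth :: "(int \<Rightarrow> 'a) set \<Rightarrow> bool" where
  "subquadratic_growth X \<longleftrightarrow>
     (\<lambda>n. real (card (words_of_length X n))) \<in> o(\<lambda>n. real n ^ 2)"

definition periodic_point :: "'a list \<Rightarrow> int \<Rightarrow> 'a" where
  "periodic_point u = (\<lambda>i. u ! nat (i mod int (length u)))"

definition num_squares :: "'a option list \<Rightarrow> nat" where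
  "num_squares u = count_list u None"

text \<open>The least is taken over \<open>nat\<close> because \<open>int\<close> is not well-ordered.\<close>

definition first_square :: "(int \<Rightarrow> 'a option) \<Rightarrow> int" where
  "first_square y = int (LEAST n. y (int n) = None)"

definition fill :: "(int \<Rightarrow> 'a option) \<Rightarrow> (int \<Rightarrow> 'a option) \<Rightarrow> int \<Rightarrow> 'a option" where
  "fill y z = (\<lambda>j. let l = first_square y in
     if y j \<noteq> None then y j
     else if j = l then z 0
     else if j > l then z (int (num_squares (subword y l (j - 1))))
     else z (- int (num_squares (subword y (j + 1) l))))"

primrec toeplitz_approx :: "'a option list \<Rightarrow> nat \<Rightarrow> int \<Rightarrow> 'a option" where
  "toeplitz_approx w 0 = (\<lambda>_. None)"
| "toeplitz_approx w (Suc i) = fill (toeplitz_approx w i) (periodic_point w)"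

text \<open>The limit is taken over the extended alphabet; it has no squares, so it is identified
  with a point over \<open>S\<close>. It is only meaningful for words \<open>w\<close> over the extended alphabet that
  contain a square and whose first and last symbols are not squares.\<close>

definition toeplitz_point :: "'a set \<Rightarrow> 'a option list \<Rightarrow> int \<Rightarrow> 'a" where
  "toeplitz_point S w =
     (THE x. limitin (full_shift_topology (insert None (Some ` S)))
               (toeplitz_approx w) (Some \<circ> x) sequentially)"

definition toeplitz_subshift :: "'a set \<Rightarrow> 'a option list \<Rightarrow> (int \<Rightarrow> 'a) set" where
  "toeplitz_subshift S w =
     full_shift_topology S closure_of {shift_pow i (toeplitz_point S w) | i. True}"

end

theory Submission
  imports Defs "HOL-Real_Asymp.Real_Asymp"
begin

text \<open>
  The point \<open>x = x(w)\<close> solves \<open>x(5k) = 1\<close>, \<open>x(5k+2) = x(5k+4) = 0\<close>, \<open>x(5k+1) = x(2k)\<close> and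
  \<open>x(5k+3) = x(2k+1)\<close>. Hence a word of length \<open>n\<close> in \<open>x\<close> is determined by its starting position
  modulo 5 together with a word of length at most \<open>2n/5 + 2\<close> in \<open>x\<close>, so the number \<open>p(n)\<close> of words
  satisfies \<open>p(n) \<le> 5 p(2n/5 + 2)\<close>. This gives \<open>p(n) = O(n\<^sup>\<alpha>)\<close> with \<open>\<alpha> = log 5 / log (5/2)\<close>,
  and \<open>\<alpha> < 2\<close> because \<open>5 < (5/2)\<^sup>2\<close>.
\<close>

section \<open>Filling squares along an enumeration\<close>

lemma num_squares_subword:
  "num_squares (subword y a b) = card {j \<in> {a..b}. y j = None}"
proof -
  have "num_squares (subword y a b) = length (filter (\<lambda>j. y j = None) [a..b])"
    by (simp add: num_squares_def subword_def count_list_eq_length_filter filter_map o_def eq_commute)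
  also have "\<dots> = card (set (filter (\<lambda>j. y j = None) [a..b]))"
    by (rule distinct_card[symmetric]) simp
  finally show ?thesis by simp
qed

text \<open>The sign conditions make \<open>e 0\<close> the least nonnegative square. Counting
  squares between \<open>e 0\<close> and \<open>e k\<close> is then counting indices between 0 and
  \<open>k\<close>, so the case distinction in \<open>fill\<close> reads \<open>z\<close> at
  \<open>k\<close> on both sides.\<close>

lemma fill_enumerated:
  fixes e :: "int \<Rightarrow> int"
  assumes mono: "strict_mono e" and sq: "\<And>j. y j = None \<longleftrightarrow> j \<in> range e"
    and e0: "0 \<le> e 0" and e1: "e (-1) < 0"
  shows "fill y z (e k) = z k"
proof -
  have less: "e a < e b \<longleftrightarrow> a < b" for a b
    using mono by (simp add: strict_mono_less)
  have le: "e a \<le> e b \<longleftrightarrow> a \<le> b" for a b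
    using mono by (simp add: strict_mono_less_eq)
  have inj: "inj e"
    using mono by (rule strict_mono_imp_inj_on)
  have "(LEAST n. y (int n) = None) = nat (e 0)"
  proof (rule Least_equality)
    show "y (int (nat (e 0))) = None" using e0 sq by simp
  next
    fix n assume "y (int n) = None"
    then obtain k where k: "int n = e k" using sq by blast
    have "0 \<le> k"
    proof (rule ccontr)
      assume "\<not> 0 \<le> k"
      then have "e k \<le> e (-1)" by (simp add: le)
      with e1 k show False by linarith
    qed
    then have "e 0 \<le> e k" by (simp add: le)
    with k show "nat (e 0) \<le> n" by linarith
  qed
  then have first: "first_square y = e 0"
    using e0 by (simp add: first_square_def)
  have num: "num_squares (subword y c d) = nat (b - a)"
    if "\<And>i. c \<le> e i \<and> e i \<le> d \<longleftrightarrow> a \<le> i \<and> i < b" for a b c d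
  proof -
    have "{j \<in> {c..d}. y j = None} = e ` {a..<b}"
      by (force simp: sq that[symmetric])
    then show ?thesis
      by (simp add: num_squares_subword card_image inj_on_subset[OF inj])
  qed
  have ek: "y (e k) = None" using sq by simp
  consider "k = 0" | "k > 0" | "k < 0" by linarith
  then show ?thesis
  proof cases
    case 1
    then show ?thesis using ek by (simp add: fill_def first)
  next
    case 2
    have "num_squares (subword y (e 0) (e k - 1)) = nat (k - 0)"
      by (rule num) (auto simp: less le)
    with 2 ek show ?thesis by (simp add: fill_def first less inj_eq[OF inj] Let_def)
  next
    case 3
    \<comment> \<open>To the left of \<open>e 0\<close> the window excludes \<open>e k\<close> but
      includes \<open>e 0\<close>: the indices are \<open>k + 1\<close> up to 0, which gives
      \<open>- k\<close> squares.\<close>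
    have "num_squares (subword y (e k + 1) (e 0)) = nat (1 - (k + 1))"
      by (rule num) (auto simp: le less zle_add1_eq_le add1_zle_eq)
    with 3 ek show ?thesis by (simp add: fill_def first less inj_eq[OF inj] Let_def)
  qed
qed

lemma fill_nonsquare: "y j \<noteq> None \<Longrightarrow> fill y z j = y j"
  by (simp add: fill_def)

section \<open>The word, its holes and the self-similar point\<close>

abbreviation w :: "nat option list" where
  "w \<equiv> [Some 1, None, Some 0, None, Some 0]"

text \<open>The \<open>k\<close>-th square of the periodic point of \<open>w\<close>.\<close>

definition hole :: "int \<Rightarrow> int" where
  "hole k = 5 * (k div 2) + 1 + 2 * (k mod 2)"

lemma hole_strict_mono: "strict_mono hole"
proof (rule strict_monoI)
  fix a b :: int assume "a < b"
  then show "hole a < hole b" unfolding hole_def by presburger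
qed

lemma range_hole: "j \<in> range hole \<longleftrightarrow> j mod 5 = 1 \<or> j mod 5 = 3"
proof
  assume "j \<in> range hole"
  then show "j mod 5 = 1 \<or> j mod 5 = 3"
    unfolding hole_def by (elim rangeE) presburger
next
  assume "j mod 5 = 1 \<or> j mod 5 = 3"
  then have "j = 5 * (j div 5) + 1 \<or> j = 5 * (j div 5) + 3"
    using mult_div_mod_eq[of 5 j] by metis
  then have "j = hole (2 * (j div 5)) \<or> j = hole (2 * (j div 5) + 1)"
    by (simp add: hole_def add.commute)
  then show "j \<in> range hole" by blast
qed

text \<open>The limit point, obtained without a limit as the solution of
  \<open>x (hole k) = x k\<close> that agrees with \<open>w\<close> repeated periodically off the
  holes. The recursion ends because passing from \<open>hole k\<close> to \<open>k\<close> lowers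
  the absolute value.\<close>

function toeplitz :: "int \<Rightarrow> nat" where
  "toeplitz j =
     (if j mod 5 = 1 then toeplitz (2 * (j div 5))
      else if j mod 5 = 3 then toeplitz (2 * (j div 5) + 1)
      else if j mod 5 = 0 then 1 else 0)"
  by auto
termination
proof (relation "inv_image less_than (\<lambda>j. nat \<bar>j\<bar>)")
  fix j :: int
  show "(2 * (j div 5), j) \<in> inv_image less_than (\<lambda>j. nat \<bar>j\<bar>)" if "j mod 5 = 1"
  proof -
    have "j = 5 * (j div 5) + 1" using mult_div_mod_eq[of 5 j] that by simp
    then have "\<bar>2 * (j div 5)\<bar> < \<bar>j\<bar>" by linarith
    then show ?thesis by simp
  qed
  show "(2 * (j div 5) + 1, j) \<in> inv_image less_than (\<lambda>j. nat \<bar>j\<bar>)" if "j mod 5 = 3"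
  proof -
    have "j = 5 * (j div 5) + 3" using mult_div_mod_eq[of 5 j] that by simp
    then have "\<bar>2 * (j div 5) + 1\<bar> < \<bar>j\<bar>" by linarith
    then show ?thesis by simp
  qed
qed auto

declare toeplitz.simps [simp del]

lemma toeplitz_hole: "toeplitz (hole k) = toeplitz k"
proof -
  consider m where "k = 2 * m" | m where "k = 2 * m + 1"
    by (metis evenE oddE)
  then show ?thesis
  proof cases
    case 1
    have "(5 * m + 1) mod 5 = 1" "(5 * m + 1) div 5 = m" by presburger+
    then show ?thesis using 1 by (simp add: hole_def toeplitz.simps[of "5 * m + 1"])
  next
    case 2
    have "hole k = 5 * m + 3" "(5 * m + 3) mod 5 = 3" "(5 * m + 3) div 5 = m"
      using 2 unfolding hole_def by presburger+
    then show ?thesis using 2 by (simp add: toeplitz.simps[of "5 * m + 3"])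
  qed
qed

lemma toeplitz_binary: "toeplitz j \<in> {0, 1}"
  by (induction j rule: toeplitz.induct) (subst toeplitz.simps, simp)

lemma periodic_point_w:
  "periodic_point w k = (if k \<in> range hole then None else Some (toeplitz k))"
proof -
  have "k mod 5 \<in> {0, 1, 2, 3, 4}" by simp presburger
  then show ?thesis
    by (auto simp: periodic_point_def range_hole toeplitz.simps[of k] numeral_eq_Suc)
qed

section \<open>Squares of the approximations\<close>

lemma hole_power_strict_mono: "strict_mono (hole ^^ i)"
proof (induction i)
  case (Suc i)
  then show ?case using hole_strict_mono by (simp add: strict_mono_def)
qed (simp add: strict_mono_def)

text \<open>With the next lemma, this supplies the sign conditions of
  \<open>fill_enumerated\<close>: \<open>hole\<close> preserves both the nonnegative and the
  negative integers.\<close>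

lemma hole_power_0: "0 \<le> (hole ^^ i) 0"
proof (induction i)
  case (Suc i)
  have "0 \<le> a \<Longrightarrow> 0 \<le> hole a" for a unfolding hole_def by presburger
  with Suc show ?case by simp
qed simp

lemma hole_power_minus_1: "(hole ^^ i) (-1) < 0"
proof (induction i)
  case (Suc i)
  have "a < 0 \<Longrightarrow> hole a < 0" for a unfolding hole_def by presburger
  with Suc show ?case by simp
qed simp

text \<open>Each application of \<open>hole\<close> increases the absolute value. Hence the squares
  move away from the origin and every coordinate is eventually filled.\<close>

lemma hole_power_ge: "int i \<le> \<bar>(hole ^^ i) k\<bar>"
proof (induction i)
  case (Suc i)
  have "\<bar>a\<bar> < \<bar>hole a\<bar>" for a
    using mult_div_mod_eq[of 2 a] pos_mod_bound[of 2 a] pos_mod_sign[of 2 a]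
    unfolding hole_def by arith
  from this[of "(hole ^^ i) k"] Suc show ?case by simp
qed simp

lemma toeplitz_hole_power: "toeplitz ((hole ^^ i) k) = toeplitz k"
  by (induction i) (simp_all add: toeplitz_hole)

text \<open>The squares left after \<open>i\<close> rounds are enumerated by
  \<open>hole ^^ i\<close>, so the next round writes \<open>periodic_point w k\<close> at
  \<open>(hole ^^ i) k\<close>. This is a square if \<open>k\<close> is a hole and
  \<open>toeplitz k\<close> otherwise, the right value since \<open>toeplitz\<close> is invariant
  under \<open>hole\<close>.\<close>

lemma toeplitz_approx_w:
  "toeplitz_approx w i = (\<lambda>j. if j \<in> range (hole ^^ i) then None else Some (toeplitz j))"
proof (induction i)
  case (Suc i)
  define y where "y = toeplitz_approx w i"
  have sq: "y j = None \<longleftrightarrow> j \<in> range (hole ^^ i)" for j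
    unfolding y_def Suc.IH by simp
  \<comment> \<open>The new \<open>hole\<close> is the inner map: it selects among the indices of
    the old squares those that remain.\<close>
  have range_Suc: "range (hole ^^ Suc i) = (hole ^^ i) ` range hole"
    by (simp only: funpow_Suc_right image_comp)
  show ?case
  proof
    fix j
    show "toeplitz_approx w (Suc i) j =
        (if j \<in> range (hole ^^ Suc i) then None else Some (toeplitz j))"
    proof (cases "j \<in> range (hole ^^ i)")
      case True
      then obtain k where k: "j = (hole ^^ i) k" by blast
      have "toeplitz_approx w (Suc i) j = periodic_point w k"
        unfolding toeplitz_approx.simps(2) y_def[symmetric] k
        by (rule fill_enumerated[OF hole_power_strict_mono sq hole_power_0 hole_power_minus_1])
      moreover have "j \<in> range (hole ^^ Suc i) \<longleftrightarrow> k \<in> range hole"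
        unfolding range_Suc k
        by (rule inj_image_mem_iff[OF strict_mono_imp_inj_on[OF hole_power_strict_mono]])
      ultimately show ?thesis
        by (simp only: periodic_point_w k toeplitz_hole_power)
    next
      case False
      moreover from False have "j \<notin> range (hole ^^ Suc i)"
        unfolding range_Suc by blast
      ultimately show ?thesis
        using fill_nonsquare[of y j "periodic_point w"]
        unfolding y_def Suc.IH toeplitz_approx.simps(2) by (simp del: funpow.simps)
    qed
  qed
qed simp

section \<open>Pointwise convergence to the self-similar point\<close>

lemma limitin_discrete_topology:
  "limitin (discrete_topology A) f l F \<longleftrightarrow> l \<in> A \<and> (\<forall>\<^sub>F n in F. f n = l)"
proof
  assume lim: "limitin (discrete_topology A) f l F"
  then have "l \<in> A" by (simp add: limitin_def)
  moreover from this lim have "\<forall>\<^sub>F n in F. f n \<in> {l}"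
    unfolding limitin_def by (metis empty_subsetI insert_subset openin_discrete_topology singletonI)
  ultimately show "l \<in> A \<and> (\<forall>\<^sub>F n in F. f n = l)" by simp
next
  assume "l \<in> A \<and> (\<forall>\<^sub>F n in F. f n = l)"
  then show "limitin (discrete_topology A) f l F"
    by (auto simp: limitin_def elim: eventually_mono)
qed

lemma limitin_full_shift_topology:
  "limitin (full_shift_topology A) f l F \<longleftrightarrow>
     range l \<subseteq> A \<and> (\<forall>\<^sub>F n in F. range (f n) \<subseteq> A) \<and> (\<forall>j. \<forall>\<^sub>F n in F. f n j = l j)"
  by (auto simp: full_shift_topology_def limitin_componentwise limitin_discrete_topology
      PiE_UNIV_domain image_subset_iff Pi_iff)

lemma toeplitz_point_w: "toeplitz_point {0, 1} w = toeplitz"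
  unfolding toeplitz_point_def
proof (rule the_equality)
  let ?A = "insert None (Some ` {0, 1 :: nat})"
  have ev: "\<forall>\<^sub>F i in sequentially. toeplitz_approx w i j = Some (toeplitz j)" for j
  proof (rule eventually_sequentiallyI)
    fix i assume "nat \<bar>j\<bar> + 1 \<le> i"
    then have "\<bar>j\<bar> < int i" by linarith
    then have "j \<notin> range (hole ^^ i)"
      by (metis hole_power_ge imageE not_le)
    then show "toeplitz_approx w i j = Some (toeplitz j)"
      unfolding toeplitz_approx_w by simp
  qed
  show "limitin (full_shift_topology ?A) (toeplitz_approx w) (Some \<circ> toeplitz) sequentially"
    unfolding limitin_full_shift_topology
  proof (intro conjI allI)
    have mem: "Some (toeplitz j) \<in> ?A" for j
      by (intro insertI2 imageI toeplitz_binary)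
    then show "range (Some \<circ> toeplitz) \<subseteq> ?A" by (intro image_subsetI) (simp only: o_apply)
    show "\<forall>\<^sub>F i in sequentially. range (toeplitz_approx w i) \<subseteq> ?A"
      unfolding toeplitz_approx_w using mem
      by (intro always_eventually allI image_subsetI) (simp only: insertI1 split: if_split, blast)
    show "\<forall>\<^sub>F i in sequentially. toeplitz_approx w i j = (Some \<circ> toeplitz) j" for j
      using ev[of j] unfolding o_apply .
  qed
  fix x assume lim: "limitin (full_shift_topology ?A) (toeplitz_approx w) (Some \<circ> x) sequentially"
  show "x = toeplitz"
  proof
    fix j
    from lim have "\<forall>\<^sub>F i in sequentially. toeplitz_approx w i j = Some (x j)"
      unfolding limitin_full_shift_topology o_apply by (elim conjE allE)
    with ev[of j] have "\<forall>\<^sub>F i in sequentially. x j = toeplitz j"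
      by eventually_elim (metis option.inject)
    \<comment> \<open>The equation does not depend on \<open>i\<close>, and
      \<open>sequentially\<close> is a nontrivial filter.\<close>
    then show "x j = toeplitz j" by simp
  qed
qed

section \<open>Words of an orbit closure\<close>

lemma words_of_length_singleton:
  "words_of_length {x} n = range (\<lambda>i. map (\<lambda>t. x (i + int t)) [0..<n])"
proof -
  have "subword x i (i + int n - 1) = map (\<lambda>t. x (i + int t)) [0..<n]" for i
    by (rule nth_equalityI) (simp_all add: subword_def)
  moreover have "length (subword x i (i + int n - 1)) = n" for i
    by (simp add: subword_def)
  ultimately show ?thesis
    by (auto simp: words_of_length_def appears_in_def)
qed

lemma words_of_length_orbit_closure:
  "words_of_length (full_shift_topology S closure_of {shift_pow i x | i. True}) n
     \<subseteq> words_of_length {x} n"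
proof
  fix u assume "u \<in> words_of_length (full_shift_topology S closure_of {shift_pow i x | i. True}) n"
  then obtain z where z: "z \<in> full_shift_topology S closure_of {shift_pow i x | i. True}"
    and "u \<in> words_of_length {z} n"
    by (auto simp: words_of_length_def)
  then obtain i where u: "u = map (\<lambda>t. z (i + int t)) [0..<n]"
    by (auto simp: words_of_length_singleton)
  \<comment> \<open>The cylinder of points that agree with \<open>z\<close> on the window of
    \<open>u\<close>. It is an open neighbourhood of \<open>z\<close>, so some shift of
    \<open>x\<close> lies in it and shows \<open>u\<close>.\<close>
  define U where "U = PiE UNIV (\<lambda>j. if j \<in> {i..<i + int n} then {z j} else S)"
  have zS: "z j \<in> S" for j
    using z by (auto simp: in_closure_of full_shift_topology_def PiE_UNIV_domain)
  have "openin (full_shift_topology S) U"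
    unfolding full_shift_topology_def U_def
  proof (rule product_topology_basis)
    show "finite {j. (if j \<in> {i..<i + int n} then {z j} else S) \<noteq> topspace (discrete_topology S)}"
      by (rule finite_subset[of _ "{i..<i + int n}"]) auto
  qed (use zS in auto)
  moreover have "z \<in> U" using zS by (auto simp: U_def)
  ultimately obtain k where "shift_pow k x \<in> U"
    using z unfolding in_closure_of by blast
  then have "shift_pow k x j \<in> (if j \<in> {i..<i + int n} then {z j} else S)" for j
    by (auto simp: U_def PiE_UNIV_domain split: if_splits)
  then have eq: "x (j + k) = z j" if "j \<in> {i..<i + int n}" for j
    using that by (metis shift_pow_def singletonD)
  have "u = map (\<lambda>t. x ((i + k) + int t)) [0..<n]"
    using eq[symmetric] by (auto simp: u algebra_simps)
  then show "u \<in> words_of_length {x} n"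
    by (auto simp: words_of_length_singleton)
qed

lemma finite_words_of_length:
  assumes "finite (range x)"
  shows "finite (words_of_length {x} n)"
  by (rule finite_subset[OF _ finite_lists_length_eq[OF assms, of n]])
    (auto simp: words_of_length_singleton)

lemma finite_range_toeplitz: "finite (range toeplitz)"
proof (rule finite_subset)
  show "range toeplitz \<subseteq> {0, 1}" by (rule image_subsetI) (rule toeplitz_binary)
qed simp

section \<open>Recursive bound on the number of words\<close>

lemma card_words_toeplitz_recursion:
  "card (words_of_length {toeplitz} n) \<le> 5 * card (words_of_length {toeplitz} ((2 * n + 10) div 5))"
proof -
  define m where "m = (2 * n + 10) div 5"
  \<comment> \<open>Decoder: if \<open>v\<close> is the window of \<open>toeplitz\<close> that
    starts at \<open>2 * k\<close>, then \<open>f r v s\<close> recovers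
    \<open>toeplitz (5 * k + s)\<close>, as long as \<open>v\<close> is long enough.\<close>
  define f :: "nat \<Rightarrow> nat list \<Rightarrow> nat \<Rightarrow> nat" where
    "f r v s = (if s mod 5 = 1 then v ! (2 * (s div 5))
                else if s mod 5 = 3 then v ! (2 * (s div 5) + 1)
                else if s mod 5 = 0 then 1 else 0)" for r v s
  define g where "g = (\<lambda>(r, v). map (\<lambda>t. f r v (r + t)) [0..<n])"
  have fin: "finite (words_of_length {toeplitz} m)"
    by (rule finite_words_of_length[OF finite_range_toeplitz])
  have "words_of_length {toeplitz} n \<subseteq> g ` ({..<5} \<times> words_of_length {toeplitz} m)"
  proof
    fix u assume "u \<in> words_of_length {toeplitz} n"
    then obtain i where u: "u = map (\<lambda>t. toeplitz (i + int t)) [0..<n]"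
      by (auto simp: words_of_length_singleton)
    define k where "k = i div 5"
    define r where "r = nat (i mod 5)"
    have r: "r < 5" and i: "i = 5 * k + int r" by (simp_all add: k_def r_def)
    define v where "v = map (\<lambda>t. toeplitz (2 * k + int t)) [0..<m]"
    have "toeplitz (i + int t) = f r v (r + t)" if "t < n" for t
    proof -
      define s where "s = r + t"
      have it: "i + int t = 5 * k + int s" by (simp add: i s_def)
      have div: "(5 * k + int s) div 5 = k + int (s div 5)"
        and mod: "(5 * k + int s) mod 5 = int (s mod 5)"
        by (simp_all add: zdiv_int zmod_int)
      have modc: "int (s mod 5) = 1 \<longleftrightarrow> s mod 5 = 1" "int (s mod 5) = 3 \<longleftrightarrow> s mod 5 = 3"
        "int (s mod 5) = 0 \<longleftrightarrow> s mod 5 = 0" by linarith+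
      \<comment> \<open>The length \<open>m\<close> suffices: the largest index read is
        \<open>(2 * s - 1) / 5\<close>, for \<open>s mod 5 = 3\<close>, and
        \<open>s \<le> n + 3\<close> bounds it by \<open>(2 * n + 5) / 5\<close>, which is less than
        \<open>m\<close>.\<close>
      have m: "2 * n + 10 < 5 * m + 5" unfolding m_def by presburger
      have s: "s < n + 4" using \<open>t < n\<close> r by (simp add: s_def)
      have lt1: "2 * (s div 5) < m" if "s mod 5 = 1"
        using mult_div_mod_eq[of 5 s] that m s by linarith
      have lt3: "2 * (s div 5) + 1 < m" if "s mod 5 = 3"
        using mult_div_mod_eq[of 5 s] that m s by linarith
      show ?thesis
        unfolding it s_def[symmetric] f_def toeplitz.simps[of "5 * k + int s"] div mod modc
        using lt1 lt3 by (auto simp: v_def algebra_simps)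
    qed
    then have "u = g (r, v)" by (simp add: u g_def)
    moreover have "v \<in> words_of_length {toeplitz} m"
      by (auto simp: v_def words_of_length_singleton)
    ultimately show "u \<in> g ` ({..<5} \<times> words_of_length {toeplitz} m)" using r by blast
  qed
  then have "card (words_of_length {toeplitz} n) \<le> card ({..<5::nat} \<times> words_of_length {toeplitz} m)"
    by (rule surj_card_le[rotated]) (simp add: fin)
  then show ?thesis by (simp add: card_cartesian_product m_def)
qed

section \<open>Solving the recursion\<close>

text \<open>One step shrinks the distance of \<open>n\<close> to 10/3 by a factor of at least 5/2
  and costs a factor 5. The exponent \<alpha> with \<open>(5/2) powr \<alpha> = 5\<close> balances
  the two.\<close>

lemma smallo_square_of_recursion:
  fixes p :: "nat \<Rightarrow> nat"
  assumes rec: "\<And>n. p n \<le> 5 * p ((2 * n + 10) div 5)"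
  shows "(\<lambda>n. real (p n)) \<in> o(\<lambda>n. real n ^ 2)"
proof -
  define \<alpha> :: real where "\<alpha> = log (5/2) 5"
  have \<alpha>: "0 < \<alpha>" "\<alpha> < 2"
    by (simp_all add: \<alpha>_def log_less_iff power2_eq_square powr_numeral)
  have pow: "(5/2) powr \<alpha> = 5" by (simp add: \<alpha>_def)
  \<comment> \<open>Chosen to give equality at \<open>n = 4\<close>, where \<open>n - 10/3\<close>
    is 2/3.\<close>
  define C where "C = real (p 4) / (2/3) powr \<alpha>"
  then have C: "0 \<le> C" by simp
  \<comment> \<open>\<open>10/3\<close> is the fixed point of \<open>n \<mapsto> (2n + 10)/5\<close>.\<close>
  have bound: "real (p n) \<le> C * (real n - 10/3) powr \<alpha>" if "4 \<le> n" for n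
    using that
  proof (induction n rule: less_induct)
    case (less n)
    show ?case
    proof (cases "n = 4")
      case True
      then show ?thesis by (simp add: C_def)
    next
      case False
      define m where "m = (2 * n + 10) div 5"
      \<comment> \<open>From \<open>n \<ge> 5\<close> a step never falls below 4, so 4 is the only
        base case and \<open>m - 10/3\<close> stays positive.\<close>
      have m: "m < n" "4 \<le> m" using False less.prems by (auto simp: m_def)
      have "5 * m \<le> 2 * n + 10" by (simp add: m_def)
      then have m_le: "5 * real m \<le> 2 * real n + 10" by linarith
      have "real (p n) \<le> 5 * real (p m)"
        using rec[of n] unfolding m_def by linarith
      also have "\<dots> \<le> 5 * (C * (real m - 10/3) powr \<alpha>)"
        using less.IH[OF m] by simp
      also have "(real m - 10/3) powr \<alpha> \<le> ((real n - 10/3) / (5/2)) powr \<alpha>"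
        using m m_le \<alpha> by (intro powr_mono2) auto
      also have "\<dots> = (real n - 10/3) powr \<alpha> / 5"
        using less.prems pow by (subst powr_divide) auto
      finally show ?thesis using C by (simp add: mult_left_mono)
    qed
  qed
  have "(\<lambda>n. real (p n)) \<in> O(\<lambda>n. C * (real n - 10/3) powr \<alpha>)"
  proof (rule landau_o.big_mono, rule eventually_sequentiallyI)
    fix n :: nat assume "4 \<le> n"
    from bound[OF this] show "norm (real (p n)) \<le> norm (C * (real n - 10/3) powr \<alpha>)" by simp
  qed
  also have "(\<lambda>n. C * (real n - 10/3) powr \<alpha>) \<in> o(\<lambda>n. real n ^ 2)"
    using \<alpha> by (cases "C = 0") (simp, real_asymp)
  finally show ?thesis .
qed

theorem lemma31:
  "subquadratic_growth
     (toeplitz_subshift {0, 1 :: nat} [Some 1, None, Some 0, None, Some 0])"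
proof -
  define X where "X = toeplitz_subshift {0, 1 :: nat} w"
  \<comment> \<open>Taking the closure adds no words, so the count for the single point
    \<open>toeplitz\<close> dominates that for the subshift.\<close>
  have "(\<lambda>n. real (card (words_of_length X n))) \<in> O(\<lambda>n. real (card (words_of_length {toeplitz} n)))"
  proof (rule landau_o.big_mono, rule always_eventually, rule allI)
    fix n
    have "words_of_length X n \<subseteq> words_of_length {toeplitz} n"
      unfolding X_def toeplitz_subshift_def toeplitz_point_w
      by (rule words_of_length_orbit_closure)
    then show "norm (real (card (words_of_length X n)))
        \<le> norm (real (card (words_of_length {toeplitz} n)))"
      by (simp add: card_mono finite_words_of_length finite_range_toeplitz)
  qed
  also have "(\<lambda>n. real (card (words_of_length {toeplitz} n))) \<in> o(\<lambda>n. real n ^ 2)"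
    by (rule smallo_square_of_recursion) (rule card_words_toeplitz_recursion)
  finally show ?thesis by (simp add: subquadratic_growth_def X_def)
qed

end
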